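(* Let $f:\mathbb{R}^{n+m}\to\mathbb{R}$ be a $C^2$ function such that $\nabla f$ is globally Lipschitz with constant $L>0$ and the Hessian $\nabla^2 f(z)$ is invertible for all $z\in\mathbb{R}^{n+m}$. (i) Consider the ODE $\dot z=-(\nabla F(z))^{-1}F(z)$. The set of saddle points of $f$ is a subset of the set of exponentially stable equilibria of this ODE. (ii) Let $s>0$, let $f$ be moreover $C^3$ (so that $\nabla^2F$ below is defined), and consider the ODE $$\dot z=-(\nabla F(z))^{-1}F(z)+\tfrac{s}{2}\Big((\nabla F(z))^{-1}\nabla^2F(z)(\nabla F(z))^{-1}F(z)-I\Big)(\nabla F(z))^{-1}F(z).$$ The set of saddle points of $f$ is a subset of the set of exponentially stable equilibria of this ODE.
   Context: Write $z=(x,y)\in\mathbb{R}^n\times\mathbb{R}^m$. A (local) saddle point of $f$ is a point $(x^\ast,y^\ast)$ having a neighbourhood $U$ such that $f(x^\ast,y)\le f(x^\ast,y^\ast)\le f(x,y^\ast)$ for all $(x,y)\in U$. Notation: $F(z)=\begin{bmatrix}\nabla_x f(z)\\-\nabla_y f(z)\end{bmatrix}$; $\nabla F$ is the Jacobian matrix of $F$; $\nabla^2F(z)$ is the second derivative (a symmetric bilinear map), and for a vector $u$ the expression $(\nabla F(z))^{-1}\nabla^2F(z)u$ denotes the matrix $v\mapsto(\nabla F(z))^{-1}\,\nabla^2F(z)[v,u]$ (above $u=(\nabla F(z))^{-1}F(z)$). An equilibrium $Z^e$ of an ODE is exponentially stable (meant locally) if it is stable (for every $\varepsilon>0$ there is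 $\delta>0$ such that $|Z(0)-Z^e|<\delta$ implies $|Z(t)-Z^e|<\varepsilon$ for all $t\ge0$) and there exist $\delta,M,\lambda>0$ such that $|Z(0)-Z^e|<\delta$ implies $|Z(t)-Z^e|\le Me^{-\lambda t}|Z(0)-Z^e|$ for all $t\ge0$. (The ODEs in (i) and (ii) are the $O(1)$- and $O(s)$-resolution ODEs of the Damped Newton iteration $z_{k+1}=z_k-s(\nabla F(z_k))^{-1}F(z_k)$.) *)

theory Defs
  imports "HOL-Analysis.Analysis"
begin

primrec Ck :: "nat \<Rightarrow> ('a::real_normed_vector \<Rightarrow> 'b::real_normed_vector) \<Rightarrow> bool" where
  "Ck 0 f \<longleftrightarrow> continuous_on UNIV f"
| "Ck (Suc k) f \<longleftrightarrow> (\<forall>x. f differentiable (at x)) \<and>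
     (\<forall>v. Ck k (\<lambda>x. frechet_derivative f (at x) v))"

definition grad :: "('a::real_inner \<Rightarrow> real) \<Rightarrow> 'a \<Rightarrow> 'a" where
  "grad f z = (THE D. GDERIV f z :> D)"

(* Hessians and Jacobians are represented by the linear maps of the matrices,
   so matrix invertibility is bijectivity and the matrix inverse is inv. *)
definition hessian :: "('a::real_inner \<Rightarrow> real) \<Rightarrow> 'a \<Rightarrow> 'a \<Rightarrow> 'a" where
  "hessian f z = frechet_derivative (grad f) (at z)"

definition jacobian :: "('a::real_normed_vector \<Rightarrow> 'b::real_normed_vector) \<Rightarrow> 'a \<Rightarrow> 'a \<Rightarrow> 'b" where
  "jacobian F z = frechet_derivative F (at z)"

definition second_derivative ::
    "('a::real_normed_vector \<Rightarrow> 'b::real_normed_vector) \<Rightarrow> 'a \<Rightarrow> 'a \<Rightarrow> 'a \<Rightarrow> 'b" where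
  "second_derivative F z v u = frechet_derivative (\<lambda>w. frechet_derivative F (at w) u) (at z) v"

definition saddle_point :: "('a::topological_space \<times> 'b::topological_space \<Rightarrow> real) \<Rightarrow> 'a \<times> 'b \<Rightarrow> bool" where
  "saddle_point f z \<longleftrightarrow> (\<exists>U. open U \<and> z \<in> U \<and>
     (\<forall>(x, y) \<in> U. f (fst z, y) \<le> f z \<and> f z \<le> f (x, snd z)))"

definition saddle_field ::
    "('a::real_inner \<times> 'b::real_inner \<Rightarrow> real) \<Rightarrow> 'a \<times> 'b \<Rightarrow> 'a \<times> 'b" where
  "saddle_field f z =
     (grad (\<lambda>x. f (x, snd z)) (fst z), - grad (\<lambda>y. f (fst z, y)) (snd z))"

definition newton_step ::
    "('a::real_inner \<times> 'b::real_inner \<Rightarrow> real) \<Rightarrow> 'a \<times> 'b \<Rightarrow> 'a \<times> 'b" where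
  "newton_step f z = inv (jacobian (saddle_field f) z) (saddle_field f z)"

definition newton_ode_O1 ::
    "('a::real_inner \<times> 'b::real_inner \<Rightarrow> real) \<Rightarrow> 'a \<times> 'b \<Rightarrow> 'a \<times> 'b" where
  "newton_ode_O1 f z = - newton_step f z"

definition newton_ode_Os ::
    "real \<Rightarrow> ('a::real_inner \<times> 'b::real_inner \<Rightarrow> real) \<Rightarrow> 'a \<times> 'b \<Rightarrow> 'a \<times> 'b" where
  "newton_ode_Os s f z =
     (let F = saddle_field f;
          u = newton_step f z;
          A = (\<lambda>v. inv (jacobian F z) (second_derivative F z v u))
      in - u + (s / 2) *\<^sub>R (A u - u))"

definition solves_ode_on ::
    "('a::real_normed_vector \<Rightarrow> 'a) \<Rightarrow> real set \<Rightarrow> (real \<Rightarrow> 'a) \<Rightarrow> bool" where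
  "solves_ode_on G J Z \<longleftrightarrow> (\<forall>t\<in>J. (Z has_vector_derivative G (Z t)) (at t within J))"

(* G need only be continuous, so solutions may be non-unique and may a priori be
   defined on a bounded time interval only.  "Z(0) = z0 implies P(t, Z(t)) for all
   t >= 0" is read as: a solution on [0, infinity) exists, and every solution, on
   whatever interval [0, T], satisfies P throughout that interval. *)
definition all_solutions_from ::
    "('a::real_normed_vector \<Rightarrow> 'a) \<Rightarrow> 'a \<Rightarrow> (real \<Rightarrow> 'a \<Rightarrow> bool) \<Rightarrow> bool" where
  "all_solutions_from G z0 P \<longleftrightarrow>
     (\<exists>Z. Z 0 = z0 \<and> solves_ode_on G {0..} Z) \<and>
     (\<forall>Z T. T > 0 \<longrightarrow> Z 0 = z0 \<longrightarrow> solves_ode_on G {0..T} Z \<longrightarrow> (\<forall>t\<in>{0..T}. P t (Z t)))"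

definition ode_stable :: "('a::real_normed_vector \<Rightarrow> 'a) \<Rightarrow> 'a \<Rightarrow> bool" where
  "ode_stable G ze \<longleftrightarrow> (\<forall>\<epsilon>>0. \<exists>\<delta>>0. \<forall>z0. norm (z0 - ze) < \<delta> \<longrightarrow>
     all_solutions_from G z0 (\<lambda>t z. norm (z - ze) < \<epsilon>))"

definition exp_stable_equilibrium :: "('a::real_normed_vector \<Rightarrow> 'a) \<Rightarrow> 'a \<Rightarrow> bool" where
  "exp_stable_equilibrium G ze \<longleftrightarrow> G ze = 0 \<and> ode_stable G ze \<and>
     (\<exists>\<delta>>0. \<exists>M>0. \<exists>r>0. \<forall>z0. norm (z0 - ze) < \<delta> \<longrightarrow>
        all_solutions_from G z0 (\<lambda>t z. norm (z - ze) \<le> M * exp (- r * t) * norm (z0 - ze)))"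

end

theory Submission
  imports Defs "HOL-Complex_Analysis.Great_Picard"
begin

text \<open>
  Write \<open>u = (\<nabla>F)\<^sup>-\<^sup>1F\<close>. At a saddle point \<open>z\<^sup>*\<close> we have \<open>F(z\<^sup>*) = 0\<close>, so \<open>u(z) = (z - z\<^sup>*) + o(|z - z\<^sup>*|)\<close>,
  and the correction \<open>(\<nabla>F)\<^sup>-\<^sup>1\<nabla>\<^sup>2F[u, u]\<close> is \<open>o(|z - z\<^sup>*|)\<close>. Hence both right-hand sides are continuous fields
  which are differentiable at \<open>z\<^sup>*\<close> with derivative \<open>-c I\<close>, where \<open>c = 1\<close> or \<open>c = 1 + s/2\<close>.
  For such a field \<open>|z - z\<^sup>*|\<^sup>2\<close> is a strict Lyapunov function near \<open>z\<^sup>*\<close>, and every solution starting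
  nearby decays exponentially. The fields need not be Lipschitz, so the existence of solutions is
  Peano's theorem, obtained from Euler step functions.
\<close>

section \<open>Peano's existence theorem\<close>

text \<open>The increment telescopes into the terms \<open>h *\<^sub>R G (x j)\<close>, and each of
  them differs from \<open>h *\<^sub>R p\<close> by at most \<open>h * \<epsilon>\<close>. The fixed
  slope \<open>p\<close> will be the value of \<open>G\<close> at the limit point.\<close>

lemma euler_increment:
  fixes x :: "nat \<Rightarrow> 'a::real_normed_vector"
  assumes step: "\<And>j. x (Suc j) = x j + h *\<^sub>R G (x j)" and "h \<ge> 0" "m \<le> n"
    and near: "\<And>j. m \<le> j \<Longrightarrow> j < n \<Longrightarrow> norm (G (x j) - p) \<le> \<epsilon>"
  shows "norm (x n - x m - (real (n - m) * h) *\<^sub>R p) \<le> real (n - m) * h * \<epsilon>"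
  using \<open>m \<le> n\<close> near
proof (induction n rule: dec_induct)
  case (step n)
  have eq: "x (Suc n) - x m - (real (Suc n - m) * h) *\<^sub>R p
      = (x n - x m - (real (n - m) * h) *\<^sub>R p) + h *\<^sub>R (G (x n) - p)"
    using step.hyps by (simp add: assms(1) Suc_diff_le algebra_simps)
  have "norm (h *\<^sub>R (G (x n) - p)) \<le> h * \<epsilon>"
    using step.prems[of n] step.hyps \<open>h \<ge> 0\<close> by (simp add: mult_left_mono)
  moreover have "norm (x n - x m - (real (n - m) * h) *\<^sub>R p) \<le> real (n - m) * h * \<epsilon>"
    using step by simp
  ultimately show ?case
    unfolding eq using step.hyps
    by (intro order_trans[OF norm_triangle_ineq]) (simp add: Suc_diff_le algebra_simps)
qed simp

text \<open>Euler's method with step 1/(k+1), kept constant between grid times instead of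
  interpolated. The functions jump, so all estimates below carry a rounding error of order 1/(k+1),
  which vanishes in the limit.\<close>

definition euler_step :: "('a::real_normed_vector \<Rightarrow> 'a) \<Rightarrow> 'a \<Rightarrow> nat \<Rightarrow> real \<Rightarrow> 'a" where
  "euler_step G z0 k t = ((\<lambda>x. x + (1 / real (Suc k)) *\<^sub>R G x) ^^ nat \<lfloor>t * real (Suc k)\<rfloor>) z0"

text \<open>This is \<open>euler_increment\<close> in continuous time. The elapsed grid time differs
  from \<open>b - a\<close> by at most one step, which accounts for the two terms with
  1/(k+1).\<close>

lemma euler_step_increment:
  assumes "0 \<le> a" "a \<le> b" "0 \<le> \<epsilon>"
    and near: "\<And>t. a \<le> t \<Longrightarrow> t \<le> b \<Longrightarrow> norm (G (euler_step G z0 k t) - p) \<le> \<epsilon>"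
  shows "norm (euler_step G z0 k b - euler_step G z0 k a - (b - a) *\<^sub>R p)
    \<le> \<epsilon> * (b - a + 1 / real (Suc k)) + norm p / real (Suc k)"
proof -
  define N where "N = real (Suc k)"
  have N: "N > 0" by (simp add: N_def)
  define x where "x j = ((\<lambda>x. x + (1 / N) *\<^sub>R G x) ^^ j) z0" for j
  have E: "euler_step G z0 k t = x (nat \<lfloor>t * N\<rfloor>)" for t
    by (simp add: euler_step_def x_def N_def)
  define m n where "m = nat \<lfloor>a * N\<rfloor>" and "n = nat \<lfloor>b * N\<rfloor>"
  have m: "real m \<le> a * N" "a * N < real m + 1" and n: "real n \<le> b * N" "b * N < real n + 1"
    using assms N unfolding m_def n_def by (auto simp: of_nat_nat)
  have mn: "m \<le> n"
    unfolding m_def n_def using assms N by (intro nat_mono floor_mono mult_right_mono) auto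
  have near': "norm (G (x j) - p) \<le> \<epsilon>" if j: "m \<le> j" "j < n" for j
  \<comment> \<open>The grid time \<open>m / N\<close> may lie before \<open>a\<close>, outside the
    range of the hypothesis. The step function takes the value \<open>x m\<close> at time
    \<open>a\<close> itself, so the hypothesis is applied there.\<close>
  proof (cases "j = m")
    case True
    then show ?thesis using near[of a] assms by (simp add: E m_def)
  next
    case False
    have "a \<le> real j / N" using m j False N by (simp add: field_simps)
    moreover have "real j / N \<le> b" using n j N by (simp add: field_simps)
    ultimately show ?thesis using near[of "real j / N"] N by (simp add: E)
  qed
  let ?d = "real (n - m) * (1 / N)"
  have *: "norm (x n - x m - ?d *\<^sub>R p) \<le> ?d * \<epsilon>"
    by (rule euler_increment[where G=G]) (use N mn near' in \<open>auto simp: x_def\<close>)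
  have "?d - (b - a) = ((real n - b * N) - (real m - a * N)) / N"
    using mn N by (simp add: of_nat_diff field_simps)
  \<comment> \<open>Both parentheses are negated fractional parts, hence lie in (-1, 0].\<close>
  moreover have "\<bar>(real n - b * N) - (real m - a * N)\<bar> \<le> 1"
    using m n by linarith
  ultimately have "\<bar>?d - (b - a)\<bar> \<le> 1 / N"
    using N by (simp add: abs_divide divide_right_mono)
  then have d: "?d \<le> b - a + 1 / N" "\<bar>?d - (b - a)\<bar> \<le> 1 / N"
    by linarith+
  have "norm (x n - x m - (b - a) *\<^sub>R p) \<le> norm (x n - x m - ?d *\<^sub>R p) + norm ((?d - (b - a)) *\<^sub>R p)"
    by (rule order_trans[OF _ norm_triangle_ineq]) (simp add: algebra_simps)
  also have "\<dots> \<le> ?d * \<epsilon> + 1 / N * norm p"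
    using * mult_right_mono[OF d(2), of "norm p"] by (intro add_mono) auto
  also have "\<dots> \<le> (b - a + 1 / N) * \<epsilon> + 1 / N * norm p"
    using d(1) \<open>0 \<le> \<epsilon>\<close> by (intro add_right_mono mult_right_mono)
  finally show ?thesis
    by (simp add: E m_def n_def N_def mult.commute)
qed

text \<open>A diagonal argument gives a subsequence converging at all rational times, and the
  approximate Lipschitz bound extends convergence to every time. The increment estimate around a
  fixed \<open>t\<close> survives the pointwise limit and yields the derivative directly, without an
  integral equation.\<close>

theorem peano_existence:
  fixes G :: "'a::euclidean_space \<Rightarrow> 'a"
  assumes cont: "continuous_on UNIV G" and bound: "\<And>x. norm (G x) \<le> M"
  obtains Z where "Z 0 = z0" "solves_ode_on G {0..} Z"
proof -
  let ?Y = "euler_step G z0"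
  have M: "M \<ge> 0" using bound[of 0] norm_ge_zero order_trans by blast
  \<comment> \<open>The increment estimate with slope \<open>p = 0\<close> and tolerance
    \<open>M\<close>.\<close>
  have lip: "norm (?Y k b - ?Y k a) \<le> M * (\<bar>b - a\<bar> + 1 / real (Suc k))" if "0 \<le> a" "0 \<le> b" for a b k
  proof (cases "a \<le> b")
    case True
    then show ?thesis using euler_step_increment[of a b M G z0 k 0] that M bound by simp
  next
    case False
    then show ?thesis using euler_step_increment[of b a M G z0 k 0] that M bound
      by (simp add: norm_minus_commute)
  qed
  have scaled_bound: "norm (?Y k q /\<^sub>R (1 + q)) \<le> norm z0 + M" if "q \<in> \<rat> \<inter> {0..}" for k q
  proof -
    have q: "q \<ge> 0" using that by simp
    have "norm (?Y k q) \<le> norm z0 + M * (q + 1 / real (Suc k))"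
      using lip[of 0 q k] q norm_triangle_ineq[of z0 "?Y k q - z0"] by (simp add: euler_step_def)
    also have "\<dots> \<le> norm z0 + M * (q + 1)"
      using M by (intro add_left_mono mult_left_mono) auto
    also have "\<dots> \<le> (norm z0 + M) * (1 + q)"
      using q by (simp add: algebra_simps)
    finally show ?thesis using q by (simp add: field_simps)
  qed
  \<comment> \<open>The factor \<open>1 / (1 + q)\<close> makes the approximations bounded uniformly on the whole half line.\<close>
  obtain \<kappa> where \<kappa>: "strict_mono (\<kappa> :: nat \<Rightarrow> nat)"
    and conv: "\<And>q. q \<in> \<rat> \<inter> {0..} \<Longrightarrow> \<exists>l. (\<lambda>i. ?Y (\<kappa> i) q /\<^sub>R (1 + q)) \<longlonglongrightarrow> l"
    using function_convergent_subsequence[of "\<rat> \<inter> {0..}" "\<lambda>k q. ?Y k q /\<^sub>R (1 + q)", OF _ scaled_bound]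
    by (metis countable_Int1 countable_rat)
  have h0: "(\<lambda>i. 1 / real (Suc (\<kappa> i))) \<longlonglongrightarrow> 0"
    using LIMSEQ_subseq_LIMSEQ[OF lim_1_over_n[where 'a=real, THEN LIMSEQ_Suc] \<kappa>] by (simp add: o_def)
  have "convergent (\<lambda>i. ?Y (\<kappa> i) t)" if t: "t \<ge> 0" for t
  proof -
    have "Cauchy (\<lambda>i. ?Y (\<kappa> i) t)"
    proof (rule CauchyI)
      fix e :: real assume e: "e > 0"
      \<comment> \<open>Moving from \<open>t\<close> to a rational \<open>q\<close> costs at most
        \<open>M * (d + d)\<close>, that is e/4. This is paid twice, plus e/4 for the difference at
        \<open>q\<close>. The summand 1 in \<open>M + 1\<close> guards against
        \<open>M = 0\<close>.\<close>
      define d where "d = e / (8 * (M + 1))"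
      have d: "d > 0" "M * d \<le> e / 8" using e M by (auto simp: d_def field_simps)
      obtain q where q: "q \<in> \<rat>" "t < q" "q < t + d"
        using Rats_dense_in_real[of t "t + d"] d by auto
      obtain l where "(\<lambda>i. ?Y (\<kappa> i) q /\<^sub>R (1 + q)) \<longlonglongrightarrow> l"
        using conv[of q] q t by auto
      then have "(\<lambda>i. (1 + q) *\<^sub>R (?Y (\<kappa> i) q /\<^sub>R (1 + q))) \<longlonglongrightarrow> (1 + q) *\<^sub>R l"
        by (intro tendsto_intros)
      then have "(\<lambda>i. ?Y (\<kappa> i) q) \<longlonglongrightarrow> (1 + q) *\<^sub>R l"
        using q t by simp
      then have "Cauchy (\<lambda>i. ?Y (\<kappa> i) q)" using LIMSEQ_imp_Cauchy by blast
      then obtain N1 where N1: "\<And>i j. i \<ge> N1 \<Longrightarrow> j \<ge> N1 \<Longrightarrow> norm (?Y (\<kappa> i) q - ?Y (\<kappa> j) q) < e / 4"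
        using CauchyD[of _ "e / 4"] e by (metis zero_less_divide_iff zero_less_numeral)
      obtain N2 where N2: "\<And>i. i \<ge> N2 \<Longrightarrow> 1 / real (Suc (\<kappa> i)) < d"
        using order_tendstoD(2)[OF h0 d(1)] by (auto simp: eventually_sequentially)
      have near: "norm (?Y (\<kappa> i) t - ?Y (\<kappa> i) q) \<le> e / 4" if "i \<ge> N2" for i
      proof -
        have "norm (?Y (\<kappa> i) t - ?Y (\<kappa> i) q) \<le> M * (\<bar>t - q\<bar> + 1 / real (Suc (\<kappa> i)))"
          using lip[of q t] q t by simp
        also have "\<dots> \<le> M * (d + d)"
          using M q N2[OF that] by (intro mult_left_mono) auto
        finally show ?thesis using d by (simp add: algebra_simps)
      qed
      show "\<exists>N. \<forall>i\<ge>N. \<forall>j\<ge>N. norm (?Y (\<kappa> i) t - ?Y (\<kappa> j) t) < e"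
      proof (intro exI[of _ "max N1 N2"] allI impI)
        fix i j assume ij: "i \<ge> max N1 N2" "j \<ge> max N1 N2"
        have "?Y (\<kappa> i) t - ?Y (\<kappa> j) t = (?Y (\<kappa> i) t - ?Y (\<kappa> i) q)
            + (?Y (\<kappa> i) q - ?Y (\<kappa> j) q) - (?Y (\<kappa> j) t - ?Y (\<kappa> j) q)" by simp
        also have "norm \<dots> \<le> norm (?Y (\<kappa> i) t - ?Y (\<kappa> i) q)
            + norm (?Y (\<kappa> i) q - ?Y (\<kappa> j) q) + norm (?Y (\<kappa> j) t - ?Y (\<kappa> j) q)"
          by (meson add_mono norm_triangle_ineq norm_triangle_ineq4 order_refl order_trans)
        also have "\<dots> < e" using near[of i] near[of j] N1[of i j] ij e by simp
        finally show "norm (?Y (\<kappa> i) t - ?Y (\<kappa> j) t) < e" .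
      qed
    qed
    then show ?thesis by (simp add: Cauchy_convergent)
  qed
  then obtain Z where Z: "\<And>t. t \<ge> 0 \<Longrightarrow> (\<lambda>i. ?Y (\<kappa> i) t) \<longlonglongrightarrow> Z t"
    unfolding convergent_def by metis
  have Z0: "Z 0 = z0"
    using LIMSEQ_unique[OF Z[of 0], of z0] by (simp add: euler_step_def)
  have "solves_ode_on G {0..} Z"
    unfolding solves_ode_on_def has_vector_derivative_def has_derivative_within_alt
  proof (intro ballI conjI allI impI)
    fix t e :: real assume t: "t \<in> {0..}" and e: "e > 0"
    have "continuous (at (Z t)) G" using cont by (simp add: continuous_on_eq_continuous_at)
    then obtain \<delta> where \<delta>: "\<delta> > 0" "\<And>y. norm (y - Z t) < \<delta> \<Longrightarrow> norm (G y - G (Z t)) \<le> e"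
      using e unfolding continuous_at_eps_delta dist_norm by (metis less_imp_le)
    \<comment> \<open>Within time \<open>\<eta>\<close> of \<open>t\<close>, and with steps shorter
      than \<open>\<eta>\<close>, an approximation moves by at most
      \<open>M * (\<eta> + \<eta>)\<close>, hence at most \<delta>/2. The other half of \<delta> is
      left for the distance from its value at \<open>t\<close> to \<open>Z t\<close>.\<close>
    define \<eta> where "\<eta> = \<delta> / (4 * (M + 1))"
    have \<eta>: "\<eta> > 0" "M * \<eta> \<le> \<delta> / 4" using \<delta> M by (auto simp: \<eta>_def field_simps)
    \<comment> \<open>Letting \<open>t\<close> lie anywhere in the interval covers the right
      derivative (\<open>a = t\<close>) and the left one (\<open>b = t\<close>) at once.\<close>
    have incr: "norm (Z b - Z a - (b - a) *\<^sub>R G (Z t)) \<le> e * (b - a)"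
      if ab: "0 \<le> a" "a \<le> t" "t \<le> b" "b - a < \<eta>" for a b
    proof (rule tendsto_le[OF sequentially_bot])
      show "(\<lambda>i. norm (?Y (\<kappa> i) b - ?Y (\<kappa> i) a - (b - a) *\<^sub>R G (Z t)))
          \<longlonglongrightarrow> norm (Z b - Z a - (b - a) *\<^sub>R G (Z t))"
        using ab by (intro tendsto_intros Z) auto
      have "(\<lambda>i. e * (b - a + 1 / real (Suc (\<kappa> i))) + norm (G (Z t)) * (1 / real (Suc (\<kappa> i))))
          \<longlonglongrightarrow> e * (b - a + 0) + norm (G (Z t)) * 0"
        by (intro tendsto_intros h0)
      then show "(\<lambda>i. e * (b - a + 1 / real (Suc (\<kappa> i))) + norm (G (Z t)) / real (Suc (\<kappa> i)))
          \<longlonglongrightarrow> e * (b - a)"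
        by simp
      have ev1: "\<forall>\<^sub>F i in sequentially. 1 / real (Suc (\<kappa> i)) < \<eta>"
        by (rule order_tendstoD(2)[OF h0 \<eta>(1)])
      have "\<forall>\<^sub>F i in sequentially. dist (?Y (\<kappa> i) t) (Z t) < \<delta> / 2"
        using t \<delta>(1) by (intro tendstoD Z) auto
      with ev1 show "\<forall>\<^sub>F i in sequentially. norm (?Y (\<kappa> i) b - ?Y (\<kappa> i) a - (b - a) *\<^sub>R G (Z t))
          \<le> e * (b - a + 1 / real (Suc (\<kappa> i))) + norm (G (Z t)) / real (Suc (\<kappa> i))"
      proof eventually_elim
        case (elim i)
        show ?case
        proof (rule euler_step_increment)
          fix \<tau> assume \<tau>: "a \<le> \<tau>" "\<tau> \<le> b"
          have "norm (?Y (\<kappa> i) \<tau> - ?Y (\<kappa> i) t) \<le> M * (\<bar>\<tau> - t\<bar> + 1 / real (Suc (\<kappa> i)))"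
            using lip[of t \<tau>] \<tau> ab by simp
          also have "\<dots> \<le> M * (\<eta> + \<eta>)"
            using elim(1) \<tau> ab M by (intro mult_left_mono) auto
          also have "\<dots> \<le> \<delta> / 2" using \<eta> by (simp add: algebra_simps)
          finally have "norm (?Y (\<kappa> i) \<tau> - Z t) < \<delta>"
            using elim(2) norm_triangle_ineq[of "?Y (\<kappa> i) \<tau> - ?Y (\<kappa> i) t" "?Y (\<kappa> i) t - Z t"]
            by (simp add: dist_norm)
          then show "norm (G (?Y (\<kappa> i) \<tau>) - G (Z t)) \<le> e" by (rule \<delta>(2))
        qed (use ab e in auto)
      qed
    qed
    have "norm (Z y - Z t - (y - t) *\<^sub>R G (Z t)) \<le> e * norm (y - t)"
      if y: "y \<in> {0..}" "norm (y - t) < \<eta>" for y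
    proof (cases "t \<le> y")
      case True
      then show ?thesis using incr[of t y] y t by simp
    next
      case False
      then have "norm (Z t - Z y - (t - y) *\<^sub>R G (Z t)) \<le> e * (t - y)"
        using incr[of y t] y t by simp
      moreover have "Z y - Z t - (y - t) *\<^sub>R G (Z t) = - (Z t - Z y - (t - y) *\<^sub>R G (Z t))"
        by (simp add: algebra_simps)
      ultimately show ?thesis using False by (simp only: norm_minus_cancel) auto
    qed
    with \<eta>(1) show "\<exists>d>0. \<forall>y\<in>{0..}. norm (y - t) < d \<longrightarrow>
        norm (Z y - Z t - (y - t) *\<^sub>R G (Z t)) \<le> e * norm (y - t)" by blast
  qed (rule bounded_linear_scaleR_left)
  with Z0 show ?thesis by (rule that)
qed

section \<open>Exponential stability\<close>

text \<open>Dissipativity holds only in a ball, so decay is first proved for as long as the solution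
  stays there. A first-exit argument then shows that it never leaves.\<close>

lemma solution_decay:
  fixes G :: "'a::real_inner \<Rightarrow> 'a"
  assumes dissip: "\<And>z. norm (z - ze) \<le> r \<Longrightarrow> (z - ze) \<bullet> G z \<le> - c * (norm (z - ze))\<^sup>2"
    and "c \<ge> 0" and sol: "solves_ode_on G {0..T} Z"
    and start: "norm (Z 0 - ze) < r" and t: "t \<in> {0..T}"
  shows "norm (Z t - ze) \<le> exp (- c * t) * norm (Z 0 - ze)"
proof -
  have contZ: "continuous_on {0..T} Z"
    using sol unfolding solves_ode_on_def continuous_on_eq_continuous_within
    using has_vector_derivative_continuous by blast
  have inside: "norm (Z t - ze) \<le> exp (- c * t) * norm (Z 0 - ze)"
    if t: "t \<in> {0..T}" and small: "\<And>s. 0 < s \<Longrightarrow> s < t \<Longrightarrow> norm (Z s - ze) \<le> r" for t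
  proof -
    \<comment> \<open>The weight turns the differential inequality for the squared distance into
      monotonicity of \<open>?V\<close>.\<close>
    let ?V = "\<lambda>s. exp (2 * c * s) * ((Z s - ze) \<bullet> (Z s - ze))"
    have "?V t \<le> ?V 0"
    proof (rule DERIV_nonpos_imp_decreasing_open[where f="?V"])
      show "0 \<le> t" using t by simp
      show "continuous_on {0..t} ?V"
        using t by (intro continuous_intros continuous_on_subset[OF contZ]) auto
      fix s assume s: "0 < s" "s < t"
      have "(Z has_vector_derivative G (Z s)) (at s within {0..T})"
        using sol s t by (auto simp: solves_ode_on_def)
      moreover have "at s within {0..T} = at s"
        using s t by (intro at_within_interior) auto
      ultimately have "(Z has_derivative (\<lambda>x. x *\<^sub>R G (Z s))) (at s)"
        by (simp add: has_vector_derivative_def)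
      then have "DERIV ?V s :> 2 * exp (2 * c * s) * (c * ((Z s - ze) \<bullet> (Z s - ze)) + (Z s - ze) \<bullet> G (Z s))"
        unfolding has_field_derivative_def
        by (auto intro!: derivative_eq_intros simp: algebra_simps inner_commute fun_eq_iff)
      moreover have "c * ((Z s - ze) \<bullet> (Z s - ze)) + (Z s - ze) \<bullet> G (Z s) \<le> 0"
        using dissip[OF small[OF s]] by (simp add: power2_norm_eq_inner)
      ultimately show "\<exists>y. DERIV ?V s :> y \<and> y \<le> 0"
        by (meson mult_nonneg_nonpos exp_ge_zero zero_le_mult_iff zero_le_numeral)
    qed
    then have "(exp (c * t) * norm (Z t - ze))\<^sup>2 \<le> (norm (Z 0 - ze))\<^sup>2"
      by (simp add: power_mult_distrib power2_norm_eq_inner exp_double[symmetric] mult.assoc)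
    then have "exp (c * t) * norm (Z t - ze) \<le> norm (Z 0 - ze)"
      by (rule power2_le_imp_le) simp
    then show ?thesis by (simp add: exp_minus field_simps)
  qed
  have "norm (Z s - ze) < r" if s: "s \<in> {0..T}" for s
  proof (rule ccontr)
    assume "\<not> norm (Z s - ze) < r"
    \<comment> \<open>If the solution reached the sphere of radius \<open>r\<close>, there would be
      a first such time \<open>t1\<close>. Before it the solution is inside the ball, so
      \<open>inside\<close> applies at \<open>t1\<close> and bounds the distance there by its
      initial value, which is below \<open>r\<close>.\<close>
    define K where "K = {0..T} \<inter> (\<lambda>s. norm (Z s - ze)) -` {r..}"
    have "closed K" unfolding K_def
      by (intro continuous_closed_preimage continuous_intros contZ)
    then have "compact K" unfolding K_def by (simp add: compact_eq_bounded_closed bounded_Int)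
    moreover have "s \<in> K" using s \<open>\<not> _\<close> by (auto simp: K_def)
    ultimately obtain t1 where t1: "t1 \<in> K" "\<And>s. s \<in> K \<Longrightarrow> t1 \<le> s"
      using compact_attains_inf[of K] by auto
    have "norm (Z t1 - ze) \<le> exp (- c * t1) * norm (Z 0 - ze)"
    proof (rule inside)
      fix s assume "0 < s" "s < t1"
      then show "norm (Z s - ze) \<le> r" using t1(1) t1(2)[of s] by (cases "norm (Z s - ze) < r") (auto simp: K_def)
    qed (use t1 in \<open>auto simp: K_def\<close>)
    also have "\<dots> \<le> norm (Z 0 - ze)"
      using t1 \<open>c \<ge> 0\<close> by (intro mult_left_le_one_le) (auto simp: K_def)
    finally show False using t1 start by (auto simp: K_def)
  qed
  then show ?thesis using t by (intro inside) (auto intro: less_imp_le)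
qed

lemma exp_stable_if_dissipative:
  fixes G :: "'a::euclidean_space \<Rightarrow> 'a"
  assumes cont: "continuous_on UNIV G" and "G ze = 0" and "r > 0" "c > 0"
    and dissip: "\<And>z. norm (z - ze) \<le> r \<Longrightarrow> (z - ze) \<bullet> G z \<le> - c * (norm (z - ze))\<^sup>2"
  shows "exp_stable_equilibrium G ze"
proof -
  have ex: "\<exists>Z. Z 0 = z0 \<and> solves_ode_on G {0..} Z" if z0: "norm (z0 - ze) < r" for z0
  proof -
    \<comment> \<open>Project onto the ball to make the field bounded; solutions never leave the ball.\<close>
    let ?P = "closest_point (cball ze r)"
    let ?G = "\<lambda>z. G (?P z)"
    have P: "?P z \<in> cball ze r" for z
      using \<open>r > 0\<close> by (intro closest_point_in_set) auto
    have same: "?G z = G z" if "norm (z - ze) \<le> r" for z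
      using that by (simp add: closest_point_self dist_norm norm_minus_commute)
    have "continuous_on UNIV ?G"
      using \<open>r > 0\<close>
      by (intro continuous_on_compose2[OF cont] continuous_on_closest_point) auto
    moreover have "bounded (G ` cball ze r)"
      by (intro compact_imp_bounded compact_continuous_image continuous_on_subset[OF cont]) auto
    then obtain M where "\<And>z. norm (?G z) \<le> M"
      using P unfolding bounded_iff by blast
    ultimately obtain Z where Z: "Z 0 = z0" "solves_ode_on ?G {0..} Z"
      using peano_existence by blast
    have "norm (Z t - ze) \<le> r" if "t \<ge> 0" for t
    proof -
      have "solves_ode_on ?G {0..t} Z"
        using Z(2) unfolding solves_ode_on_def
        by (metis Icc_subset_Ici_iff atLeastAtMost_iff atLeast_iff has_vector_derivative_within_subset order_refl)
      then have "norm (Z t - ze) \<le> exp (- c * t) * norm (Z 0 - ze)"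
        using dissip same z0 Z(1) that \<open>c > 0\<close> by (intro solution_decay[where r=r and T=t]) auto
      also have "\<dots> \<le> norm (Z 0 - ze)"
        using that \<open>c > 0\<close> by (intro mult_left_le_one_le) auto
      finally show ?thesis using z0 Z(1) by simp
    qed
    then have "solves_ode_on G {0..} Z"
      using Z(2) same by (simp add: solves_ode_on_def)
    with Z(1) show ?thesis by blast
  qed
  have decay: "norm (Z t - ze) \<le> exp (- c * t) * norm (z0 - ze)"
    if "norm (z0 - ze) < r" "Z 0 = z0" "solves_ode_on G {0..T} Z" "t \<in> {0..T}" for z0 Z t T
    using solution_decay[OF dissip] that \<open>c > 0\<close> by (metis less_imp_le)
  have "ode_stable G ze"
    unfolding ode_stable_def
  proof (intro allI impI)
    fix e :: real assume e: "e > 0"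
    have "all_solutions_from G z0 (\<lambda>t z. norm (z - ze) < e)" if z0: "norm (z0 - ze) < min r e" for z0
      unfolding all_solutions_from_def
    proof (intro conjI allI impI ballI)
      show "\<exists>Z. Z 0 = z0 \<and> solves_ode_on G {0..} Z" using ex z0 by simp
      fix Z T t assume Z: "Z 0 = z0" "solves_ode_on G {0..T} Z" and t: "t \<in> {0..T}"
      have "norm (Z t - ze) \<le> exp (- c * t) * norm (z0 - ze)"
        using decay[OF _ Z t] z0 by simp
      also have "\<dots> \<le> norm (z0 - ze)"
        using t \<open>c > 0\<close> by (intro mult_left_le_one_le) auto
      finally show "norm (Z t - ze) < e" using z0 by simp
    qed
    then show "\<exists>\<delta>>0. \<forall>z0. norm (z0 - ze) < \<delta> \<longrightarrow> all_solutions_from G z0 (\<lambda>t z. norm (z - ze) < e)"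
      using e \<open>r > 0\<close> by (metis min_less_iff_conj)
  qed
  moreover have "all_solutions_from G z0 (\<lambda>t z. norm (z - ze) \<le> 1 * exp (- c * t) * norm (z0 - ze))"
    if "norm (z0 - ze) < r" for z0
    unfolding all_solutions_from_def using ex[OF that] decay[OF that] by simp
  ultimately show ?thesis
    unfolding exp_stable_equilibrium_def using \<open>G ze = 0\<close> \<open>r > 0\<close> \<open>c > 0\<close> zero_less_one by blast
qed

text \<open>Near \<open>ze\<close> the field is \<open>- c *\<^sub>R (z - ze)\<close> plus a
  remainder of norm at most \<open>c / 2 * norm (z - ze)\<close>. By Cauchy-Schwarz the remainder
  costs at most half of the dissipation, leaving the rate c/2.\<close>

theorem exp_stable_if_derivative_scaling:
  fixes G :: "'a::euclidean_space \<Rightarrow> 'a"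
  assumes cont: "continuous_on UNIV G" and "G ze = 0" and "c > 0"
    and deriv: "(G has_derivative (\<lambda>v. - c *\<^sub>R v)) (at ze)"
  shows "exp_stable_equilibrium G ze"
proof -
  obtain d where d: "d > 0"
    "\<And>z. norm (z - ze) < d \<Longrightarrow> norm (G z - G ze - (- c *\<^sub>R (z - ze))) \<le> c / 2 * norm (z - ze)"
    using deriv \<open>c > 0\<close> unfolding has_derivative_at_alt by (meson half_gt_zero)
  have "(z - ze) \<bullet> G z \<le> - (c / 2) * (norm (z - ze))\<^sup>2" if "norm (z - ze) \<le> d / 2" for z
  proof -
    have "norm (G z + c *\<^sub>R (z - ze)) \<le> c / 2 * norm (z - ze)"
      using d(2)[of z] d(1) that \<open>G ze = 0\<close> by simp
    then have "norm (z - ze) * norm (G z + c *\<^sub>R (z - ze)) \<le> norm (z - ze) * (c / 2 * norm (z - ze))"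
      by (intro mult_left_mono) auto
    then have "(z - ze) \<bullet> (G z + c *\<^sub>R (z - ze)) \<le> c / 2 * (norm (z - ze))\<^sup>2"
      using norm_cauchy_schwarz[of "z - ze" "G z + c *\<^sub>R (z - ze)"]
      by (simp add: power2_eq_square algebra_simps)
    moreover have "(z - ze) \<bullet> (G z + c *\<^sub>R (z - ze)) = (z - ze) \<bullet> G z + c * (norm (z - ze))\<^sup>2"
      by (simp add: inner_add_right power2_norm_eq_inner)
    ultimately show ?thesis by (simp add: algebra_simps)
  qed
  then show ?thesis
    using d(1) \<open>c > 0\<close> \<open>G ze = 0\<close> cont by (intro exp_stable_if_dissipative[where r="d/2" and c="c/2"]) auto
qed

section \<open>The Newton direction\<close>

lemma linear_Basis_expansion:
  fixes D :: "'a::euclidean_space \<Rightarrow> 'b::real_vector"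
  assumes "linear D"
  shows "D v = (\<Sum>b\<in>Basis. (v \<bullet> b) *\<^sub>R D b)"
proof -
  have "D (\<Sum>b\<in>Basis. (v \<bullet> b) *\<^sub>R b) = (\<Sum>b\<in>Basis. (v \<bullet> b) *\<^sub>R D b)"
    by (simp add: assms linear_scale linear_sum)
  then show ?thesis by (simp only: euclidean_representation)
qed

text \<open>In finite dimension this converts convergence of \<open>J z b\<close> for each basis
  vector \<open>b\<close> into a bound uniform over all arguments, in place of the operator
  norm.\<close>

lemma norm_linear_le_Basis:
  fixes D :: "'a::euclidean_space \<Rightarrow> 'b::real_normed_vector"
  assumes "linear D"
  shows "norm (D v) \<le> norm v * (\<Sum>b\<in>Basis. norm (D b))"
proof -
  have "norm (\<Sum>b\<in>Basis. (v \<bullet> b) *\<^sub>R D b) \<le> (\<Sum>b\<in>Basis. norm v * norm (D b))"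
    by (intro sum_norm_le) (simp add: Basis_le_norm mult_right_mono)
  then show ?thesis
    by (simp only: linear_Basis_expansion[OF assms, of v, symmetric] sum_distrib_left)
qed

text \<open>The instance in mind is the Jacobian. Continuity is stated vector by vector because that
  is the form in which \<open>Ck\<close> provides it.\<close>

locale invertible_family =
  fixes J :: "'b::topological_space \<Rightarrow> 'a::euclidean_space \<Rightarrow> 'a"
  assumes linear: "\<And>z. linear (J z)" and bij: "\<And>z. bij (J z)"
    and cont: "\<And>v. continuous_on UNIV (\<lambda>z. J z v)"
begin

lemma tendsto_apply_const: "((\<lambda>z. J z v) \<longlongrightarrow> J z0 v) (at z0)"
  using cont[of v] by (simp add: continuous_on_def)

text \<open>A lower bound \<open>B\<close> for \<open>J z0\<close> survives as B/2 under
  perturbations of size at most B/2, so nearby inverses have norm at most 2/B.\<close>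

lemma inv_locally_bounded:
  obtains C where "\<forall>\<^sub>F z in nhds z0. \<forall>w. norm (inv (J z) w) \<le> C * norm w"
proof -
  obtain B where B: "B > 0" "\<And>v. B * norm v \<le> norm (J z0 v)"
    using linear_inj_bounded_below_pos[of "J z0"] linear bij bij_is_inj by blast
  have lim: "((\<lambda>z. J z v) \<longlongrightarrow> J z0 v) (nhds z0)" for v
    using tendsto_apply_const by (simp add: tendsto_nhds_iff)
  have "((\<lambda>z. \<Sum>b\<in>Basis. norm (J z b - J z0 b)) \<longlongrightarrow> (\<Sum>b\<in>Basis. norm (J z0 b - J z0 b))) (nhds z0)"
    by (intro tendsto_intros lim)
  then have "\<forall>\<^sub>F z in nhds z0. (\<Sum>b\<in>Basis. norm (J z b - J z0 b)) < B / 2"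
    by (rule order_tendstoD) (use B in simp)
  then have "\<forall>\<^sub>F z in nhds z0. \<forall>w. norm (inv (J z) w) \<le> 2 / B * norm w"
  proof eventually_elim
    case (elim z)
    show ?case
    proof
      fix w
      define v where "v = inv (J z) w"
      have w: "J z v = w" by (simp add: v_def bij bij_is_surj surj_f_inv_f)
      have "norm (J z v - J z0 v) \<le> norm v * (\<Sum>b\<in>Basis. norm (J z b - J z0 b))"
        using norm_linear_le_Basis[of "\<lambda>v. J z v - J z0 v" v] linear
        by (simp add: linear_compose_sub)
      also have "\<dots> \<le> norm v * (B / 2)" using elim by (intro mult_left_mono) auto
      finally have "norm (J z0 v) \<le> norm (J z v) + norm v * (B / 2)"
        using norm_triangle_ineq2[of "J z0 v" "J z v"] by (simp add: norm_minus_commute)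
      then have "B * norm v \<le> 2 * norm w" using B(2)[of v] by (simp add: w algebra_simps)
      then show "norm (inv (J z) w) \<le> 2 / B * norm w"
        using B(1) by (simp add: v_def field_simps)
    qed
  qed
  then show ?thesis by (rule that)
qed

lemma linear_inv: "linear (inv (J z))"
  by (rule inj_linear_imp_inv_linear[OF linear bij_is_inj[OF bij]])

text \<open>The error of a guess \<open>v\<close> for the solution of \<open>J z v = w\<close> is
  the inverse applied to the residual. Together with local boundedness of the inverses, it therefore
  suffices to estimate residuals.\<close>

lemma inv_diff: "inv (J z) w - v = inv (J z) (w - J z v)"
  by (simp add: linear_diff[OF linear_inv] inv_f_f[OF bij_is_inj[OF bij]])

lemma continuous_on_inv_apply:
  assumes g: "continuous_on UNIV g"
  shows "continuous_on UNIV (\<lambda>z. inv (J z) (g z))"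
  unfolding continuous_on_def
proof
  fix z0
  define y where "y = inv (J z0) (g z0)"
  have y: "J z0 y = g z0" by (simp add: y_def bij bij_is_surj surj_f_inv_f)
  obtain C where C: "\<forall>\<^sub>F z in nhds z0. \<forall>w. norm (inv (J z) w) \<le> C * norm w"
    using inv_locally_bounded by blast
  have "((\<lambda>z. C * norm (g z - J z y)) \<longlongrightarrow> C * norm (g z0 - J z0 y)) (at z0)"
    using g by (intro tendsto_intros tendsto_apply_const) (simp add: continuous_on_def)
  then have "((\<lambda>z. C * norm (g z - J z y)) \<longlongrightarrow> 0) (at z0)" by (simp add: y)
  moreover have "\<forall>\<^sub>F z in at z0. norm (inv (J z) (g z) - y) \<le> C * norm (g z - J z y)"
    using C by (auto simp: eventually_at_filter inv_diff elim: eventually_mono)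
  ultimately have "((\<lambda>z. inv (J z) (g z) - y) \<longlongrightarrow> 0) (at z0)"
    by (rule Lim_null_comparison[rotated])
  then show "((\<lambda>z. inv (J z) (g z)) \<longlongrightarrow> inv (J z0) (g z0)) (at z0)"
    unfolding y_def[symmetric] by (rule Lim_null[THEN iffD2])
qed

end

text \<open>The guess for the Newton direction is \<open>z - ze\<close>. Its residual splits into
  the Taylor remainder of \<open>F\<close> at \<open>ze\<close> and \<open>J z - J ze\<close>
  applied to \<open>z - ze\<close>; both are o(|z - ze|).\<close>

lemma newton_direction_has_derivative:
  fixes F :: "'a::euclidean_space \<Rightarrow> 'a"
  assumes "invertible_family J" and F: "(F has_derivative J ze) (at ze)" and "F ze = 0"
  shows "((\<lambda>z. inv (J z) (F z)) has_derivative (\<lambda>v. v)) (at ze)"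
proof -
  interpret invertible_family J by fact
  obtain C where C: "\<forall>\<^sub>F z in nhds ze. \<forall>w. norm (inv (J z) w) \<le> C * norm w"
    using inv_locally_bounded by blast
  have inv0: "inv (J ze) (F ze) = 0"
    by (simp add: \<open>F ze = 0\<close> linear_0[OF linear_inv])
  \<comment> \<open>\<open>?q\<close> measures the Taylor remainder and \<open>?s\<close> dominates
    the operator norm of \<open>J z - J ze\<close>. The absolute value of \<open>C\<close> appears
    below because its sign is unknown.\<close>
  let ?q = "\<lambda>z. norm (F z - F ze - J ze (z - ze)) / norm (z - ze)"
  let ?s = "\<lambda>z. \<Sum>b\<in>Basis. norm (J z b - J ze b)"
  have "(?q \<longlongrightarrow> 0) (at ze)" using F by (simp add: has_derivative_iff_norm)
  moreover have "(?s \<longlongrightarrow> (\<Sum>b\<in>Basis. norm (J ze b - J ze b))) (at ze)"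
    by (intro tendsto_intros tendsto_apply_const)
  ultimately have "((\<lambda>z. \<bar>C\<bar> * (?q z + ?s z)) \<longlongrightarrow> \<bar>C\<bar> * (0 + (\<Sum>b\<in>Basis. norm (J ze b - J ze b)))) (at ze)"
    by (intro tendsto_mult tendsto_add tendsto_const)
  then have lim: "((\<lambda>z. \<bar>C\<bar> * (?q z + ?s z)) \<longlongrightarrow> 0) (at ze)" by simp
  have "\<forall>\<^sub>F z in at ze. \<forall>w. norm (inv (J z) w) \<le> C * norm w"
    using C by (auto simp: eventually_at_filter elim: eventually_mono)
  then have "\<forall>\<^sub>F z in at ze. norm (norm (inv (J z) (F z) - inv (J ze) (F ze) - (z - ze)) / norm (z - ze))
      \<le> \<bar>C\<bar> * (?q z + ?s z)"
    using eventually_neq_at_within[of ze ze]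
  proof eventually_elim
    case (elim z)
    then have z: "norm (z - ze) > 0" by simp
    have "norm (inv (J z) (F z) - inv (J ze) (F ze) - (z - ze)) \<le> \<bar>C\<bar> * norm (F z - J z (z - ze))"
      using elim(1) unfolding inv0 diff_zero inv_diff
      by (meson abs_ge_self mult_right_mono norm_ge_zero order_trans)
    also have "norm (F z - J z (z - ze)) \<le> norm (F z - F ze - J ze (z - ze)) + norm (J z (z - ze) - J ze (z - ze))"
      using norm_triangle_ineq4[of "F z - F ze - J ze (z - ze)" "J z (z - ze) - J ze (z - ze)"] \<open>F ze = 0\<close> by simp
    also have "norm (J z (z - ze) - J ze (z - ze)) \<le> norm (z - ze) * ?s z"
      using norm_linear_le_Basis[of "\<lambda>v. J z v - J ze v" "z - ze"] linear by (simp add: linear_compose_sub)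
    finally have "norm (inv (J z) (F z) - inv (J ze) (F ze) - (z - ze)) \<le>
        \<bar>C\<bar> * (norm (F z - F ze - J ze (z - ze)) + norm (z - ze) * ?s z)"
      by (simp add: mult_left_mono)
    then have "norm (inv (J z) (F z) - inv (J ze) (F ze) - (z - ze)) / norm (z - ze) \<le>
        \<bar>C\<bar> * (norm (F z - F ze - J ze (z - ze)) + norm (z - ze) * ?s z) / norm (z - ze)"
      using z by (intro divide_right_mono) auto
    also have "\<dots> = \<bar>C\<bar> * (?q z + ?s z)"
      using z by (simp add: add_divide_distrib distrib_left)
    finally show ?case by simp
  qed
  then have "((\<lambda>z. norm (inv (J z) (F z) - inv (J ze) (F ze) - (z - ze)) / norm (z - ze)) \<longlongrightarrow> 0) (at ze)"
    by (rule Lim_null_comparison[OF _ lim])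
  then show ?thesis by (simp add: has_derivative_iff_norm bounded_linear_ident)
qed

text \<open>A product rule for a factor \<open>q\<close> that is merely continuous: as
  \<open>p x = 0\<close>, the variation of \<open>q\<close> enters only at second order. It is
  applied to the matrix of the correction term, which contains second derivatives of F and is only
  known to be continuous.\<close>

lemma has_derivative_scaleR_null:
  fixes p :: "'a::real_normed_vector \<Rightarrow> real"
  assumes p: "(p has_derivative p') (at x)" and "p x = 0" and q: "isCont q x"
  shows "((\<lambda>z. p z *\<^sub>R q z) has_derivative (\<lambda>h. p' h *\<^sub>R q x)) (at x)"
proof -
  have bl: "bounded_linear p'" using p by (rule has_derivative_bounded_linear)
  obtain K where K: "K \<ge> 0" "\<And>h. norm (p' h) \<le> norm h * K"
    using bounded_linear.nonneg_bounded[OF bl] by blast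
  let ?d = "\<lambda>z. norm (p z - p x - p' (z - x)) / norm (z - x)"
  have "(?d \<longlongrightarrow> 0) (at x)" using p by (simp add: has_derivative_iff_norm)
  then have "((\<lambda>z. ?d z * norm (q z) + K * norm (q z - q x)) \<longlongrightarrow> 0 * norm (q x) + K * norm (q x - q x)) (at x)"
    using q unfolding isCont_def by (intro tendsto_intros)
  then have lim: "((\<lambda>z. ?d z * norm (q z) + K * norm (q z - q x)) \<longlongrightarrow> 0) (at x)" by simp
  have "\<forall>\<^sub>F z in at x. norm (norm (p z *\<^sub>R q z - p x *\<^sub>R q x - p' (z - x) *\<^sub>R q x) / norm (z - x))
      \<le> ?d z * norm (q z) + K * norm (q z - q x)"
    using eventually_neq_at_within[of x x]
  proof eventually_elim
    case (elim z)
    then have z: "norm (z - x) > 0" by simp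
    have "p z *\<^sub>R q z - p x *\<^sub>R q x - p' (z - x) *\<^sub>R q x
        = (p z - p x - p' (z - x)) *\<^sub>R q z + p' (z - x) *\<^sub>R (q z - q x)"
      using \<open>p x = 0\<close> by (simp add: algebra_simps)
    also have "norm \<dots> \<le> norm (p z - p x - p' (z - x)) * norm (q z) + norm (p' (z - x)) * norm (q z - q x)"
      by (metis norm_scaleR norm_triangle_ineq real_norm_def)
    also have "\<dots> \<le> norm (p z - p x - p' (z - x)) * norm (q z) + (norm (z - x) * K) * norm (q z - q x)"
      using K(2) by (intro add_left_mono mult_right_mono) auto
    finally show ?case using z by (simp add: field_simps)
  qed
  then have "((\<lambda>z. norm (p z *\<^sub>R q z - p x *\<^sub>R q x - p' (z - x) *\<^sub>R q x) / norm (z - x)) \<longlongrightarrow> 0) (at x)"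
    by (rule Lim_null_comparison[OF _ lim])
  then show ?thesis
    by (simp add: has_derivative_iff_norm bounded_linear_scaleR_const[OF bl])
qed

section \<open>Gradients and saddle fields\<close>

lemma Ck_Suc_differentiable: "Ck (Suc k) f \<Longrightarrow> f differentiable (at z)"
  by simp

lemma Ck_bounded_linear:
  assumes S: "bounded_linear S"
  shows "Ck k g \<Longrightarrow> Ck k (\<lambda>x. S (g x))"
proof (induction k arbitrary: g)
  case 0
  then show ?case by (simp add: bounded_linear.continuous_on[OF S])
next
  case (Suc k)
  have D: "((\<lambda>x. S (g x)) has_derivative (\<lambda>v. S (frechet_derivative g (at x) v))) (at x)" for x
    using Suc.prems by (intro bounded_linear.has_derivative[OF S]) (simp add: frechet_derivative_works)
  have "frechet_derivative (\<lambda>x. S (g x)) (at x) = (\<lambda>v. S (frechet_derivative g (at x) v))" for x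
    using frechet_derivative_at[OF D] by simp
  then show ?case using Suc D by (auto simp: differentiable_def)
qed

lemma Ck_sum:
  assumes "finite B"
  shows "(\<And>b. b \<in> B \<Longrightarrow> Ck k (g b)) \<Longrightarrow> Ck k (\<lambda>x. \<Sum>b\<in>B. g b x)"
proof (induction k arbitrary: g)
  case 0
  then show ?case by (auto intro: continuous_on_sum)
next
  case (Suc k)
  have D: "((\<lambda>x. \<Sum>b\<in>B. g b x) has_derivative (\<lambda>v. \<Sum>b\<in>B. frechet_derivative (g b) (at x) v)) (at x)" for x
    using Suc.prems by (intro has_derivative_sum) (simp add: frechet_derivative_works)
  have "frechet_derivative (\<lambda>x. \<Sum>b\<in>B. g b x) (at x) = (\<lambda>v. \<Sum>b\<in>B. frechet_derivative (g b) (at x) v)" for x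
    using frechet_derivative_at[OF D] by simp
  moreover have "(\<lambda>x. \<Sum>b\<in>B. g b x) differentiable (at x)" for x
    using D by (rule differentiableI)
  ultimately show ?case using Suc by simp
qed

lemma inner_right_eqI: "(\<lambda>h. h \<bullet> a) = (\<lambda>h. h \<bullet> b) \<Longrightarrow> a = b"
  by (rule vector_eq_ldot[THEN iffD1]) (simp add: fun_eq_iff)

text \<open>The explicit sum settles existence for the definite description in \<open>grad\<close>,
  and it shows the gradient as a finite sum of directional derivatives, from which its regularity is
  read off.\<close>

lemma
  fixes f :: "'a::euclidean_space \<Rightarrow> real"
  assumes "f differentiable (at z)"
  shows GDERIV_grad: "GDERIV f z :> grad f z"
    and grad_eq_sum: "grad f z = (\<Sum>b\<in>Basis. frechet_derivative f (at z) b *\<^sub>R b)"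
proof -
  let ?D = "frechet_derivative f (at z)" and ?g = "\<Sum>b\<in>Basis. frechet_derivative f (at z) b *\<^sub>R b"
  have D: "(f has_derivative ?D) (at z)" using assms by (simp add: frechet_derivative_works)
  have "?D = (\<lambda>h. h \<bullet> ?g)"
  proof
    show "?D h = h \<bullet> ?g" for h
      using linear_Basis_expansion[OF linear_frechet_derivative[OF assms], of h]
      by (simp add: inner_sum_right mult.commute)
  qed
  then have G: "GDERIV f z :> ?g" using D by (simp add: gderiv_def)
  moreover have "d = ?g" if "GDERIV f z :> d" for d
  proof -
    have "(\<lambda>h. h \<bullet> d) = (\<lambda>h. h \<bullet> ?g)"
      using that G unfolding gderiv_def by (rule has_derivative_unique)
    then show ?thesis by (rule inner_right_eqI)
  qed
  ultimately show "grad f z = ?g" unfolding grad_def by (rule the_equality)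
  with G show "GDERIV f z :> grad f z" by simp
qed

lemma Ck_grad:
  fixes f :: "'a::euclidean_space \<Rightarrow> real"
  assumes "Ck (Suc k) f"
  shows "Ck k (grad f)"
proof -
  have "Ck k (\<lambda>z. \<Sum>b\<in>Basis. frechet_derivative f (at z) b *\<^sub>R b)"
    using assms by (intro Ck_sum Ck_bounded_linear[OF bounded_linear_scaleR_left]) auto
  moreover have "grad f = (\<lambda>z. \<Sum>b\<in>Basis. frechet_derivative f (at z) b *\<^sub>R b)"
    using assms by (auto simp: grad_eq_sum)
  ultimately show ?thesis by simp
qed

section \<open>The saddle field as the gradient with its second component negated\<close>

definition flip_snd :: "'a \<times> 'b::ab_group_add \<Rightarrow> 'a \<times> 'b" where
  "flip_snd p = (fst p, - snd p)"

lemma bounded_linear_flip_snd: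
  "bounded_linear (flip_snd :: 'a::real_normed_vector \<times> 'b::real_normed_vector \<Rightarrow> 'a \<times> 'b)"
  unfolding flip_snd_def
  by (intro bounded_linear_Pair bounded_linear_fst bounded_linear_minus bounded_linear_snd)

lemma bij_flip_snd: "bij flip_snd"
  by (rule o_bij[of flip_snd]) (auto simp: flip_snd_def)

lemma
  fixes f :: "'a::euclidean_space \<times> 'b::euclidean_space \<Rightarrow> real"
  assumes "f differentiable (at z)"
  shows has_derivative_partial_fst:
      "((\<lambda>x. f (x, snd z)) has_derivative (\<lambda>h. h \<bullet> fst (grad f z))) (at (fst z))"
    and has_derivative_partial_snd:
      "((\<lambda>y. f (fst z, y)) has_derivative (\<lambda>h. h \<bullet> snd (grad f z))) (at (snd z))"
proof -
  have D: "(f has_derivative (\<lambda>h. h \<bullet> grad f z)) (at (fst z, snd z))"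
    using GDERIV_grad[OF assms] by (simp add: gderiv_def)
  have "((\<lambda>x. (x, snd z)) has_derivative (\<lambda>h. (h, 0))) (at (fst z))"
    by (intro derivative_intros)
  from has_derivative_compose[OF this D]
  show "((\<lambda>x. f (x, snd z)) has_derivative (\<lambda>h. h \<bullet> fst (grad f z))) (at (fst z))"
    by (simp add: inner_prod_def)
  have "((\<lambda>y. (fst z, y)) has_derivative (\<lambda>h. (0, h))) (at (snd z))"
    by (intro derivative_intros)
  from has_derivative_compose[OF this D]
  show "((\<lambda>y. f (fst z, y)) has_derivative (\<lambda>h. h \<bullet> snd (grad f z))) (at (snd z))"
    by (simp add: inner_prod_def)
qed

lemma grad_unique:
  fixes f :: "'a::euclidean_space \<Rightarrow> real"
  assumes "(f has_derivative (\<lambda>h. h \<bullet> d)) (at z)"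
  shows "grad f z = d"
proof -
  have "f differentiable (at z)" using assms by (auto simp: differentiable_def)
  then have "(\<lambda>h. h \<bullet> grad f z) = (\<lambda>h. h \<bullet> d)"
    by (intro has_derivative_unique[OF _ assms] GDERIV_grad[unfolded gderiv_def])
  then show ?thesis by (rule inner_right_eqI)
qed

lemma saddle_field_eq:
  fixes f :: "'a::euclidean_space \<times> 'b::euclidean_space \<Rightarrow> real"
  assumes "f differentiable (at z)"
  shows "saddle_field f z = flip_snd (grad f z)"
  unfolding saddle_field_def flip_snd_def
  using has_derivative_partial_fst[OF assms] has_derivative_partial_snd[OF assms]
  by (simp add: grad_unique)

text \<open>The first component minimises its section locally and the second maximises its own, so
  both partial gradients vanish by Fermat's rule. The product neighbourhood supplies an open set for
  each section.\<close>

lemma saddle_field_saddle_point: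
  fixes f :: "'a::euclidean_space \<times> 'b::euclidean_space \<Rightarrow> real"
  assumes "f differentiable (at z)" and "saddle_point f z"
  shows "saddle_field f z = 0"
proof -
  obtain U where U: "open U" "z \<in> U"
    "\<And>x y. (x, y) \<in> U \<Longrightarrow> f (fst z, y) \<le> f z \<and> f z \<le> f (x, snd z)"
    using assms(2) unfolding saddle_point_def by blast
  have "(fst z, snd z) \<in> U" using U by simp
  then obtain A B where AB: "open A" "open B" "fst z \<in> A" "snd z \<in> B" "A \<times> B \<subseteq> U"
    using U(1) by (auto elim!: open_prod_elim)
  have "(\<lambda>h. h \<bullet> fst (grad f z)) = (\<lambda>h. 0)"
    by (rule differential_zero_maxmin[OF AB(3,1) has_derivative_partial_fst[OF assms(1)]])
      (use U AB in auto)
  moreover have "(\<lambda>h. h \<bullet> snd (grad f z)) = (\<lambda>h. 0)"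
    by (rule differential_zero_maxmin[OF AB(4,2) has_derivative_partial_snd[OF assms(1)]])
      (use U AB in auto)
  ultimately have "fst (grad f z) = 0" "snd (grad f z) = 0"
    by (auto intro: inner_right_eqI)
  then show ?thesis by (simp add: saddle_field_eq[OF assms(1)] flip_snd_def zero_prod_def)
qed

lemma saddle_field_Ck:
  fixes f :: "'a::euclidean_space \<times> 'b::euclidean_space \<Rightarrow> real"
  assumes "Ck (Suc k) f"
  shows "Ck k (saddle_field f)"
proof -
  have "saddle_field f = (\<lambda>z. flip_snd (grad f z))"
    by (rule ext) (rule saddle_field_eq[OF Ck_Suc_differentiable[OF assms]])
  then show ?thesis using Ck_bounded_linear[OF bounded_linear_flip_snd Ck_grad[OF assms]] by simp
qed

text \<open>The Jacobian is the Hessian followed by the involution \<open>flip_snd\<close>, so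
  invertibility carries over.\<close>

lemma bij_jacobian_saddle_field:
  fixes f :: "'a::euclidean_space \<times> 'b::euclidean_space \<Rightarrow> real"
  assumes "Ck 2 f" and "bij (hessian f z)"
  shows "bij (jacobian (saddle_field f) z)"
proof -
  have C: "Ck (Suc (Suc 0)) f" using assms(1) by (simp only: numeral_2_eq_2)
  have "saddle_field f = (\<lambda>z. flip_snd (grad f z))"
    by (rule ext) (rule saddle_field_eq[OF Ck_Suc_differentiable[OF C]])
  moreover have "(grad f has_derivative hessian f z) (at z)"
    using Ck_Suc_differentiable[OF Ck_grad[OF C]] by (simp add: hessian_def frechet_derivative_works)
  ultimately have "(saddle_field f has_derivative (\<lambda>v. flip_snd (hessian f z v))) (at z)"
    by (simp add: bounded_linear.has_derivative[OF bounded_linear_flip_snd])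
  then have "jacobian (saddle_field f) z = flip_snd \<circ> hessian f z"
    unfolding jacobian_def comp_def by (rule frechet_derivative_at[symmetric])
  then show ?thesis using bij_comp[OF assms(2) bij_flip_snd] by simp
qed

section \<open>Newton direction and second-order correction of a \<open>Ck\<close> field\<close>

lemma Ck_Suc_imp_Ck: "Ck (Suc k) f \<Longrightarrow> Ck k f"
proof (induction k arbitrary: f)
  case 0
  then show ?case
    by (simp add: continuous_at_imp_continuous_on differentiable_imp_continuous_within)
next
  case (Suc k)
  from Suc.prems show ?case
    unfolding Ck.simps(2)[of k f] Ck.simps(2)[of "Suc k" f] using Suc.IH by blast
qed

lemma invertible_family_jacobian:
  fixes F :: "'a::euclidean_space \<Rightarrow> 'a"
  assumes "Ck (Suc 0) F" and "\<And>z. bij (jacobian F z)"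
  shows "invertible_family (jacobian F)"
proof (rule invertible_family.intro)
  show "linear (jacobian F z)" for z
    unfolding jacobian_def by (intro linear_frechet_derivative Ck_Suc_differentiable[OF assms(1)])
  show "continuous_on UNIV (\<lambda>z. jacobian F z v)" for v
    using assms(1) by (simp add: jacobian_def)
qed (rule assms(2))

lemma linear_second_derivative_left:
  assumes "Ck (Suc (Suc 0)) F"
  shows "linear (\<lambda>v. second_derivative F z v u)"
  unfolding second_derivative_def using assms by (intro linear_frechet_derivative) simp

text \<open>Here \<open>u\<close> sits inside the differentiated map, so linearity comes from that
  of the first derivative at every point and uniqueness of derivatives, rather than from
  symmetry.\<close>

lemma linear_second_derivative_right:
  assumes C: "Ck (Suc (Suc 0)) F"
  shows "linear (\<lambda>u. second_derivative F z v u)"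
proof -
  have lin: "linear (frechet_derivative F (at w))" for w
    using C by (simp add: linear_frechet_derivative)
  have D: "((\<lambda>w. frechet_derivative F (at w) u) has_derivative (\<lambda>v. second_derivative F z v u)) (at z)" for u
    unfolding second_derivative_def using C by (simp add: frechet_derivative_works[symmetric])
  show ?thesis
  proof (rule linearI)
    fix a b
    have "((\<lambda>w. frechet_derivative F (at w) (a + b)) has_derivative
        (\<lambda>v. second_derivative F z v a + second_derivative F z v b)) (at z)"
      unfolding linear_add[OF lin] by (intro has_derivative_add D)
    from has_derivative_unique[OF D this]
    show "second_derivative F z v (a + b) = second_derivative F z v a + second_derivative F z v b"
      by (rule fun_cong)
  next
    fix r a
    have "((\<lambda>w. frechet_derivative F (at w) (r *\<^sub>R a)) has_derivative
        (\<lambda>v. r *\<^sub>R second_derivative F z v a)) (at z)"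
      unfolding linear_scale[OF lin] by (intro has_derivative_scaleR_right D)
    from has_derivative_unique[OF D this]
    show "second_derivative F z v (r *\<^sub>R a) = r *\<^sub>R second_derivative F z v a"
      by (rule fun_cong)
  qed
qed

lemma
  fixes F :: "'a::euclidean_space \<Rightarrow> 'a"
  assumes C: "Ck (Suc 0) F" and bij: "\<And>z. bij (jacobian F z)" and "F ze = 0"
  defines "u \<equiv> \<lambda>z. inv (jacobian F z) (F z)"
  shows newton_direction_continuous: "continuous_on UNIV u"
    and newton_direction_zero: "u ze = 0"
    and newton_direction_derivative: "(u has_derivative (\<lambda>v. v)) (at ze)"
proof -
  interpret invertible_family "jacobian F"
    by (rule invertible_family_jacobian[OF C bij])
  show "continuous_on UNIV u"
    unfolding u_def using Ck_Suc_imp_Ck[OF C] by (intro continuous_on_inv_apply) simp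
  show "u ze = 0"
    by (simp add: u_def \<open>F ze = 0\<close> linear_0[OF linear_inv])
  have "(F has_derivative jacobian F ze) (at ze)"
    using C by (simp add: jacobian_def frechet_derivative_works[symmetric])
  then show "(u has_derivative (\<lambda>v. v)) (at ze)"
    unfolding u_def using \<open>F ze = 0\<close> invertible_family_axioms
    by (intro newton_direction_has_derivative)
qed

text \<open>The correction is quadratic in \<open>u\<close>, which vanishes at \<open>ze\<close>.
  Expanding one copy of \<open>u\<close> in the basis gives products of a scalar vanishing at
  \<open>ze\<close> with a continuous factor \<open>A z b\<close>; the other copy makes that factor
  vanish at \<open>ze\<close> too, so the derivative is zero.\<close>

lemma
  fixes F :: "'a::euclidean_space \<Rightarrow> 'a"
  assumes C: "Ck (Suc (Suc 0)) F" and bij: "\<And>z. bij (jacobian F z)" and "F ze = 0" 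
  defines "u \<equiv> \<lambda>z. inv (jacobian F z) (F z)"
  defines "A \<equiv> \<lambda>z v. inv (jacobian F z) (second_derivative F z v (u z))"
  shows newton_correction_continuous: "continuous_on UNIV (\<lambda>z. A z (u z))"
    and newton_correction_derivative: "((\<lambda>z. A z (u z)) has_derivative (\<lambda>v. 0)) (at ze)"
proof -
  note C1 = Ck_Suc_imp_Ck[OF C]
  interpret invertible_family "jacobian F"
    by (rule invertible_family_jacobian[OF C1 bij])
  have u: "continuous_on UNIV u" "u ze = 0" "(u has_derivative (\<lambda>v. v)) (at ze)"
    unfolding u_def using newton_direction_continuous newton_direction_zero newton_direction_derivative
    C1 bij \<open>F ze = 0\<close> by blast+
  have linA: "linear (A z)" for z
    using linear_compose[OF linear_second_derivative_left[OF C] linear_inv] by (simp add: A_def o_def)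
  have A_sum: "A z (u z) = (\<Sum>b\<in>Basis. (u z \<bullet> b) *\<^sub>R A z b)" for z
    by (rule linear_Basis_expansion[OF linA])
  have contA: "continuous_on UNIV (\<lambda>z. A z b)" for b
    unfolding A_def
  proof (rule continuous_on_inv_apply)
    \<comment> \<open>Continuity of the second derivative is known only for fixed directions; the
      expansion moves the varying argument \<open>u z\<close> into scalar coefficients.\<close>
    have "continuous_on UNIV (\<lambda>z. \<Sum>b'\<in>Basis. (u z \<bullet> b') *\<^sub>R second_derivative F z b b')"
      using C by (intro continuous_intros u) (simp add: second_derivative_def)
    then show "continuous_on UNIV (\<lambda>z. second_derivative F z b (u z))"
      by (simp only: linear_Basis_expansion[OF linear_second_derivative_right[OF C], symmetric])
  qed
  show "continuous_on UNIV (\<lambda>z. A z (u z))"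
    unfolding A_sum by (intro continuous_intros contA u)
  have A0: "A ze b = 0" for b
    unfolding A_def u(2) linear_0[OF linear_second_derivative_right[OF C]]
    by (rule linear_0[OF linear_inv])
  have "((\<lambda>z. (u z \<bullet> b) *\<^sub>R A z b) has_derivative (\<lambda>h. (h \<bullet> b) *\<^sub>R A ze b)) (at ze)" for b
    using contA[of b] u(2) has_derivative_inner_left[OF u(3)]
    by (intro has_derivative_scaleR_null) (auto simp: continuous_on_eq_continuous_at)
  then have "((\<lambda>z. \<Sum>b\<in>Basis. (u z \<bullet> b) *\<^sub>R A z b) has_derivative (\<lambda>h. \<Sum>b\<in>Basis. (h \<bullet> b) *\<^sub>R A ze b)) (at ze)"
    by (rule has_derivative_sum)
  then show "((\<lambda>z. A z (u z)) has_derivative (\<lambda>v. 0)) (at ze)"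
    by (simp add: A_sum A0)
qed

theorem theorem4p13:
  fixes f :: "(real ^ 'n) \<times> (real ^ 'm) \<Rightarrow> real" and L :: real
  assumes "Ck 2 f"
    and "L > 0" and "L-lipschitz_on UNIV (grad f)"
    and "\<And>z. bij (hessian f z)"
  shows "{z. saddle_point f z} \<subseteq> {z. exp_stable_equilibrium (newton_ode_O1 f) z} \<and>
    (\<forall>s>0. Ck 3 f \<longrightarrow>
       {z. saddle_point f z} \<subseteq> {z. exp_stable_equilibrium (newton_ode_Os s f) z})"
proof (intro conjI subsetI allI impI CollectI; drule CollectD)
  have C: "Ck (Suc 0) (saddle_field f)"
    using assms(1) by (intro saddle_field_Ck) (simp only: numeral_2_eq_2)
  have bij: "bij (jacobian (saddle_field f) z)" for z
    using assms by (intro bij_jacobian_saddle_field)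
  fix ze assume "saddle_point f ze"
  moreover have "f differentiable (at ze)"
    using assms(1) by (intro Ck_Suc_differentiable) (simp only: numeral_2_eq_2)
  ultimately have F0: "saddle_field f ze = 0" by (intro saddle_field_saddle_point)
  have u_def: "newton_step f = (\<lambda>z. inv (jacobian (saddle_field f) z) (saddle_field f z))"
    by (simp add: fun_eq_iff newton_step_def)
  note u = newton_direction_continuous[OF C bij F0, folded u_def]
    newton_direction_zero[OF C bij F0, folded newton_step_def]
    newton_direction_derivative[OF C bij F0, folded u_def]
  show "exp_stable_equilibrium (newton_ode_O1 f) ze"
  proof (rule exp_stable_if_derivative_scaling[where c=1])
    show "continuous_on UNIV (newton_ode_O1 f)"
      unfolding newton_ode_O1_def by (intro continuous_intros u)
    show "(newton_ode_O1 f has_derivative (\<lambda>v. - 1 *\<^sub>R v)) (at ze)"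
      unfolding newton_ode_O1_def using has_derivative_minus[OF u(3)] by simp
  qed (simp_all add: newton_ode_O1_def u(2))
  fix s :: real assume "s > 0" "Ck 3 f"
  then have C2: "Ck (Suc (Suc 0)) (saddle_field f)"
    by (intro saddle_field_Ck) (simp only: numeral_3_eq_3)
  let ?Au = "\<lambda>z. inv (jacobian (saddle_field f) z)
    (second_derivative (saddle_field f) z (newton_step f z) (newton_step f z))"
  have Au: "continuous_on UNIV ?Au" "(?Au has_derivative (\<lambda>v. 0)) (at ze)"
    using newton_correction_continuous[OF C2 bij F0] newton_correction_derivative[OF C2 bij F0]
    by (simp_all add: newton_step_def)
  have Au0: "?Au ze = 0"
    unfolding u(2) linear_0[OF linear_second_derivative_right[OF C2]]
    using newton_direction_zero[OF C bij F0] by (simp add: F0)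
  have G: "newton_ode_Os s f = (\<lambda>z. - newton_step f z + (s / 2) *\<^sub>R (?Au z - newton_step f z))"
    by (simp add: fun_eq_iff newton_ode_Os_def Let_def)
  \<comment> \<open>The correction \<open>?Au\<close> has zero derivative at \<open>ze\<close> and
    the Newton direction has the identity, so the linearisation is -I - (s/2) I, whence
    \<open>c = 1 + s / 2\<close>.\<close>
  show "exp_stable_equilibrium (newton_ode_Os s f) ze"
  proof (rule exp_stable_if_derivative_scaling[where c="1 + s / 2"])
    show "continuous_on UNIV (newton_ode_Os s f)"
      unfolding G by (intro continuous_intros u Au)
    have "(newton_ode_Os s f has_derivative (\<lambda>v. - v + (s / 2) *\<^sub>R (0 - v))) (at ze)"
      unfolding G by (intro derivative_intros u Au)
    then show "(newton_ode_Os s f has_derivative (\<lambda>v. - (1 + s / 2) *\<^sub>R v)) (at ze)"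
      by (simp add: algebra_simps)
    show "newton_ode_Os s f ze = 0" using Au0 u(2) by (simp add: G)
  qed (use \<open>s > 0\<close> in simp)
qed

end
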